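(* Let $G$ be an ordered abelian group and let $S_1,S_2$ be final segments of $G$. 1) Assume that $\mathcal{G}(S_2)\subsetneq\mathcal{G}(S_1)$. Then there exists an element $\alpha\in S_2$ such that $S_2':=(\alpha+\mathcal{G}(S_1))^+\subsetneq S_2$ is the largest final segment contained in $S_2$ having invariance group $\mathcal{G}(S_1)$. 2) Assume that $\mathcal{G}(S_1)=\mathcal{G}(S_2)$ and $S_1/\mathcal{G}(S_1)$ is nonprincipal, but $S_2/\mathcal{G}(S_1)$ is principal, say $S_2/\mathcal{G}(S_1)=(\alpha/\mathcal{G}(S_1))^-$ for some $\alpha\in S_2$. Then $S_2':=(\alpha+\mathcal{G}(S_1))^+\subsetneq S_2$ is the largest final segment contained in $S_2$ such that $S_2'/\mathcal{G}(S_1)$ is nonprincipal. In both cases, the following condition is satisfied: $\mathcal{G}(S_1)\subseteq\mathcal{G}(S_2')$, and $S_2'/\mathcal{G}(S_2')$ is nonprincipal if $S_1/\mathcal{G}(S_2')$ is nonprincipal. Moreover, in both cases $T=S_2'-_{\rm fs}S_1$ is the largest final segment $T$ of $G$ with $S_1+T=S_2'$, and $S_2'-_{\rm fs}S_1=S_2-_{\rm fs}S_1$.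
   Context: "Ordered" means totally ordered. A final segment of an ordered abelian group $G$ is a subset $S\subseteq G$ that is upward closed, nonempty and $\ne G$. It is principal if it has a smallest element, and nonprincipal otherwise. "Largest" refers to inclusion. For $\alpha\in G$, $\alpha^-:=\{\gamma\in G\mid\gamma\ge\alpha\}$. For nonempty $M\subseteq G$, $M^+:=\{\gamma\in G\mid\gamma>m\text{ for all }m\in M\}$. Sums of subsets are elementwise. For final segments, $S_2-_{\rm fs}S_1:=\{\alpha\in G\mid\alpha+S_1\subseteq S_2\}$. The invariance group of $M\subseteq G$ is $\mathcal{G}(M):=\{\gamma\in G\mid M+\gamma=M\}$; for a final segment $S$, $\mathcal{G}(S)$ is a proper convex subgroup of $G$. For a convex subgroup $H$ of $G$, $G/H$ carries the canonical induced ordering ($\alpha\le\beta\Rightarrow\alpha+H\le\beta+H$), $\gamma/H$ denotes the coset of $\gamma$ as an element of $G/H$, and $M/H:=\{\gamma/H\mid\gamma\in M\}$. If $S$ is a final segment of $G$ and $H$ is proper, then $S/H$ is a final segment of $G/H$. *)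

theory Defs
  imports "HOL-Library.Set_Algebras"
begin

text \<open>
  The ordered abelian group is a type \<open>'a :: linordered_ab_group_add\<close>. Its quotients by convex
  subgroups depend on a term and so are not types; they are represented as sets of cosets. The
  order-theoretic notions therefore take the carrier \<open>C\<close> and the order relation \<open>le\<close> as parameters.
  From \<open>Set_Algebras\<close>, \<open>A + B\<close> is the elementwise sum of sets and \<open>a +o B\<close> is the translate (coset)
  of \<open>B\<close> by \<open>a\<close>.
\<close>

definition final_segment_in :: "'b set \<Rightarrow> ('b \<Rightarrow> 'b \<Rightarrow> bool) \<Rightarrow> 'b set \<Rightarrow> bool" where
  "final_segment_in C le S \<longleftrightarrow>
     S \<subseteq> C \<and> S \<noteq> {} \<and> S \<noteq> C \<and> (\<forall>x\<in>S. \<forall>y\<in>C. le x y \<longrightarrow> y \<in> S)"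

definition principal_in :: "'b set \<Rightarrow> ('b \<Rightarrow> 'b \<Rightarrow> bool) \<Rightarrow> 'b set \<Rightarrow> bool" where
  "principal_in C le S \<longleftrightarrow> final_segment_in C le S \<and> (\<exists>m\<in>S. \<forall>x\<in>S. le m x)"

definition nonprincipal_in :: "'b set \<Rightarrow> ('b \<Rightarrow> 'b \<Rightarrow> bool) \<Rightarrow> 'b set \<Rightarrow> bool" where
  "nonprincipal_in C le S \<longleftrightarrow> final_segment_in C le S \<and> \<not> (\<exists>m\<in>S. \<forall>x\<in>S. le m x)"

text \<open>The segment written \<open>\<alpha>\<close> with superscript minus: all elements greater than or equal to \<open>\<alpha>\<close>.\<close>

definition segment_from_in :: "'b set \<Rightarrow> ('b \<Rightarrow> 'b \<Rightarrow> bool) \<Rightarrow> 'b \<Rightarrow> 'b set" where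
  "segment_from_in C le \<alpha> = {\<gamma> \<in> C. le \<alpha> \<gamma>}"

abbreviation final_segment :: "'a::linordered_ab_group_add set \<Rightarrow> bool" where
  "final_segment \<equiv> final_segment_in UNIV (\<le>)"

text \<open>The segment written \<open>M\<close> with superscript plus.\<close>

definition strict_upper :: "'a::linordered_ab_group_add set \<Rightarrow> 'a set" where
  "strict_upper M = {\<gamma>. \<forall>m\<in>M. \<gamma> > m}"

definition fs_diff :: "'a::linordered_ab_group_add set \<Rightarrow> 'a set \<Rightarrow> 'a set"
    (infixl "-\<^sub>f\<^sub>s" 65) where
  "S2 -\<^sub>f\<^sub>s S1 = {\<alpha>. \<alpha> +o S1 \<subseteq> S2}"

definition invariance_group :: "'a::linordered_ab_group_add set \<Rightarrow> 'a set" where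
  "invariance_group M = {\<gamma>. \<gamma> +o M = M}"

text \<open>The image \<open>M/H\<close> of \<open>M\<close> in \<open>G/H\<close>; in particular \<open>G/H\<close> itself is \<open>quot UNIV H\<close>.\<close>

definition quot :: "'a::linordered_ab_group_add set \<Rightarrow> 'a set \<Rightarrow> 'a set set" where
  "quot M H = (\<lambda>\<gamma>. \<gamma> +o H) ` M"

text \<open>
  The ordering of \<open>G/H\<close> induced by that of \<open>G\<close>: the least relation on cosets satisfying
  \<open>\<alpha> \<le> \<beta> \<Longrightarrow> \<alpha>/H \<le> \<beta>/H\<close>. It is a total order whenever \<open>H\<close> is a convex subgroup. (The
  relation \<open>\<le>\<close> on the type of sets is inclusion and must not be used for this.)
\<close>

definition coset_le :: "'a::linordered_ab_group_add set \<Rightarrow> 'a set \<Rightarrow> bool" where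
  "coset_le A B \<longleftrightarrow> (\<exists>a\<in>A. \<exists>b\<in>B. a \<le> b)"

abbreviation quot_principal :: "'a::linordered_ab_group_add set \<Rightarrow> 'a set \<Rightarrow> bool" where
  "quot_principal S H \<equiv> principal_in (quot UNIV H) coset_le (quot S H)"

abbreviation quot_nonprincipal :: "'a::linordered_ab_group_add set \<Rightarrow> 'a set \<Rightarrow> bool" where
  "quot_nonprincipal S H \<equiv> nonprincipal_in (quot UNIV H) coset_le (quot S H)"

definition largest_final_segment ::
    "('a::linordered_ab_group_add set \<Rightarrow> bool) \<Rightarrow> 'a set \<Rightarrow> bool" where
  "largest_final_segment P S \<longleftrightarrow>
     final_segment S \<and> P S \<and> (\<forall>T. final_segment T \<and> P T \<longrightarrow> T \<subseteq> S)"

end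

(*
  Write H for the invariance group of S1 and S' for (\<alpha> + H)^+. The invariance group of S' is again H.
  If \<delta> > 0 lies outside H, then some s in S1 has s - \<delta> outside S1. Applied to \<delta> = x - \<alpha> with x in S',
  this s gives x - s + S1 \<subseteq> S', because S1 is stable under H; hence S1 + (S' -fs S1) = S'. The same s
  transports the absence of a least coset from S1 to S'.

  The element \<alpha> is chosen so that every subset of S2 of the required kind (H-stable in the first
  case, without least H-coset in the second) lies above \<alpha> + H. This gives the maximality of S', and,
  applied to the translates of S1 contained in S2, the equality S' -fs S1 = S2 -fs S1.
*)
theory Submission
  imports Defs
begin

section \<open>Convex subgroups and translates\<close>

text \<open>Closure under differences together with 0 packs the subgroup laws into one clause.
  Convexity is stated only between 0 and a member; translating by members gives it for arbitrary
  intervals.\<close>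

definition convex_subgroup :: "'a::linordered_ab_group_add set \<Rightarrow> bool" where
  "convex_subgroup H \<longleftrightarrow>
     0 \<in> H \<and> (\<forall>x\<in>H. \<forall>y\<in>H. x - y \<in> H) \<and> (\<forall>x\<in>H. \<forall>y. 0 \<le> y \<and> y \<le> x \<longrightarrow> y \<in> H)"

lemma convex_subgroup_uminus: "convex_subgroup H \<Longrightarrow> h \<in> H \<Longrightarrow> - h \<in> H"
  unfolding convex_subgroup_def by (metis diff_0)

lemma convex_subgroup_add: "convex_subgroup H \<Longrightarrow> h \<in> H \<Longrightarrow> k \<in> H \<Longrightarrow> h + k \<in> H"
  using convex_subgroup_uminus[of H k] unfolding convex_subgroup_def
  by (metis diff_minus_eq_add)

lemma convex_subgroup_less:
  assumes "convex_subgroup H" "h \<in> H" "d \<notin> H" "0 < d"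
  shows "h < d"
  using assms unfolding convex_subgroup_def by (meson leI less_imp_le)

lemma final_segmentD: "final_segment S \<Longrightarrow> x \<in> S \<Longrightarrow> x \<le> y \<Longrightarrow> y \<in> S"
  unfolding final_segment_in_def by blast

lemma mem_translate_iff: "x \<in> a +o B \<longleftrightarrow> x - a \<in> B"
  for a :: "'a::linordered_ab_group_add"
proof
  assume "x - a \<in> B"
  moreover have "x = a + (x - a)" by simp
  ultimately show "x \<in> a +o B" unfolding elt_set_plus_def by blast
qed (auto simp: elt_set_plus_def)

lemma mem_strict_upper_translate_iff:
  "x \<in> strict_upper (\<alpha> +o H) \<longleftrightarrow> (\<forall>h\<in>H. \<alpha> + h < x)"
  unfolding strict_upper_def elt_set_plus_def by auto

section \<open>Invariance groups of final segments\<close>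

lemma mem_invariance_group_iff: "g \<in> invariance_group M \<longleftrightarrow> (\<forall>x. x + g \<in> M \<longleftrightarrow> x \<in> M)"
proof -
  have "g \<in> invariance_group M \<longleftrightarrow> (\<forall>x. x - g \<in> M \<longleftrightarrow> x \<in> M)"
    unfolding invariance_group_def by (auto simp: set_eq_iff mem_translate_iff)
  also have "\<dots> \<longleftrightarrow> (\<forall>x. x + g \<in> M \<longleftrightarrow> x \<in> M)"
    by (metis add_diff_cancel diff_add_cancel)
  finally show ?thesis .
qed

lemma convex_subgroup_invariance_group:
  assumes "final_segment S"
  shows "convex_subgroup (invariance_group S)"
  unfolding convex_subgroup_def
proof (intro conjI ballI allI impI)
  show "0 \<in> invariance_group S" by (simp add: mem_invariance_group_iff)
next
  fix g k assume "g \<in> invariance_group S" "k \<in> invariance_group S"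
  then show "g - k \<in> invariance_group S"
    unfolding mem_invariance_group_iff by (metis add_diff_eq diff_add_cancel)
next
  fix g k assume g: "g \<in> invariance_group S" and k: "0 \<le> k \<and> k \<le> g"
  \<comment> \<open>Sandwich: x \<le> x + k \<le> x + g. Upward closure gives each passage to the
    right, and invariance under g closes the circle.\<close>
  have "x + k \<in> S \<longleftrightarrow> x \<in> S" for x
  proof
    assume "x + k \<in> S"
    then have "x + g \<in> S" by (rule final_segmentD[OF assms]) (use k in simp)
    then show "x \<in> S" using g by (simp add: mem_invariance_group_iff)
  next
    assume "x \<in> S"
    then show "x + k \<in> S" by (rule final_segmentD[OF assms]) (use k in simp)
  qed
  then show "k \<in> invariance_group S" by (simp add: mem_invariance_group_iff)
qed

text \<open>A member x and a nonmember y are exchanged by the translation by y - x. Properness is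
  what later keeps (\<alpha> + H)^+ nonempty.\<close>

lemma invariance_group_proper:
  assumes "final_segment S"
  shows "invariance_group S \<noteq> UNIV"
proof
  assume U: "invariance_group S = UNIV"
  obtain x y where "x \<in> S" "y \<notin> S"
    using assms unfolding final_segment_in_def by blast
  moreover have "x + (y - x) \<in> S \<longleftrightarrow> x \<in> S"
    using U mem_invariance_group_iff by blast
  ultimately show False by simp
qed

text \<open>Adding a positive d never leaves S, so the only way for d to fail to be invariant is
  that subtracting d leaves S somewhere.\<close>

lemma final_segment_drop_out:
  assumes S: "final_segment S" and d: "d \<notin> invariance_group S" "0 < d"
  obtains s where "s \<in> S" "s - d \<notin> S"
proof (rule ccontr)
  assume "\<not> thesis"
  then have *: "s \<in> S \<Longrightarrow> s - d \<in> S" for s using that by blast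
  have "x + d \<in> S \<longleftrightarrow> x \<in> S" for x
    using *[of "x + d"] final_segmentD[OF S, of x "x + d"] d by auto
  with d show False by (simp add: mem_invariance_group_iff)
qed

text \<open>Supplies the \<alpha> of the first case. If h lies in H but is not invariant, then h is
  nonzero and -h has the same property; one of the two is positive, so the previous lemma applies to
  it.\<close>

lemma invariance_group_drop_out:
  assumes S: "final_segment S" and H: "convex_subgroup H" and "\<not> H \<subseteq> invariance_group S"
  obtains s h where "s \<in> S" "h \<in> H" "s - h \<notin> S"
proof -
  obtain h where h: "h \<in> H" "h \<notin> invariance_group S" using assms by blast
  have "- h \<notin> invariance_group S"
    using h convex_subgroup_uminus[OF convex_subgroup_invariance_group[OF S], of "- h"] by auto
  moreover have "h \<noteq> 0"
    using h convex_subgroup_invariance_group[OF S] by (auto simp: convex_subgroup_def)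
  ultimately obtain k where "k \<in> H" "k \<notin> invariance_group S" "0 < k"
    using h convex_subgroup_uminus[OF H h(1)] by (metis neg_0_less_iff_less neqE)
  then show ?thesis using final_segment_drop_out[OF S] that by metis
qed

section \<open>The segments (\<alpha> + H)^+\<close>

text \<open>Since 0 is in H, every element of the segment exceeds \<alpha>; strictness is witnessed
  by \<alpha> itself.\<close>

lemma strict_upper_translate_subset:
  assumes "final_segment S" "\<alpha> \<in> S" "convex_subgroup H"
  shows "strict_upper (\<alpha> +o H) \<subset> S"
proof -
  have 0: "0 \<in> H" using assms by (simp add: convex_subgroup_def)
  have "x \<in> S" if "x \<in> strict_upper (\<alpha> +o H)" for x
    using that 0 final_segmentD[OF assms(1,2), of x]
    by (force simp: mem_strict_upper_translate_iff)
  moreover have "\<alpha> \<notin> strict_upper (\<alpha> +o H)"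
    using 0 by (force simp: mem_strict_upper_translate_iff)
  ultimately show ?thesis using assms by blast
qed

lemma final_segment_strict_upper_translate:
  assumes H: "convex_subgroup H" "H \<noteq> UNIV"
  shows "final_segment (strict_upper (\<alpha> +o H))"
proof -
  obtain d where "d \<notin> H" using H by blast
  moreover have "d \<noteq> 0" "- d \<notin> H"
    using H convex_subgroup_uminus[OF H(1), of "- d"] \<open>d \<notin> H\<close> by (auto simp: convex_subgroup_def)
  \<comment> \<open>One of d and -d is positive. By convexity it exceeds all of H, so \<alpha> + e
    lies in the segment.\<close>
  ultimately obtain e where e: "e \<notin> H" "0 < e"
    by (metis neg_0_less_iff_less neqE)
  then have "\<alpha> + e \<in> strict_upper (\<alpha> +o H)"
    using convex_subgroup_less[OF H(1)] by (simp add: mem_strict_upper_translate_iff)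
  moreover have "\<alpha> \<notin> strict_upper (\<alpha> +o H)"
    using H by (force simp: mem_strict_upper_translate_iff convex_subgroup_def)
  moreover have "y \<in> strict_upper (\<alpha> +o H)"
    if "x \<in> strict_upper (\<alpha> +o H)" "x \<le> y" for x y
    using that by (auto simp: mem_strict_upper_translate_iff)
  ultimately show ?thesis unfolding final_segment_in_def by blast
qed

text \<open>These are the two conditions under which x - \<alpha> can serve as the drop in
  \<open>final_segment_drop_out\<close>.\<close>

lemma diff_notin_of_mem_strict_upper:
  assumes "convex_subgroup H" "x \<in> strict_upper (\<alpha> +o H)"
  shows "x - \<alpha> \<notin> H" "0 < x - \<alpha>"
proof -
  have less: "\<alpha> + h < x" if "h \<in> H" for h
    using assms(2) that by (simp add: mem_strict_upper_translate_iff)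
  show "x - \<alpha> \<notin> H" using less[of "x - \<alpha>"] by auto
  show "0 < x - \<alpha>" using less[of 0] assms(1) by (simp add: convex_subgroup_def)
qed

lemma invariance_group_strict_upper_translate:
  assumes H: "convex_subgroup H" "H \<noteq> UNIV"
  shows "invariance_group (strict_upper (\<alpha> +o H)) = H" (is "invariance_group ?S = H")
proof
  \<comment> \<open>The bound \<alpha> + k < x + h amounts to \<alpha> + (k - h) < x, and k - h is
    again in H.\<close>
  have up: "x + h \<in> ?S" if "x \<in> ?S" "h \<in> H" for x h
  proof -
    have "\<alpha> + k < x + h" if "k \<in> H" for k
    proof -
      have "k - h \<in> H" using H \<open>k \<in> H\<close> \<open>h \<in> H\<close> by (simp add: convex_subgroup_def)
      then have "\<alpha> + (k - h) < x"
        using \<open>x \<in> ?S\<close> by (simp add: mem_strict_upper_translate_iff)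
      then show ?thesis by (simp add: algebra_simps)
    qed
    then show ?thesis by (simp add: mem_strict_upper_translate_iff)
  qed
  show "H \<subseteq> invariance_group ?S"
  proof
    fix h assume "h \<in> H"
    then have "x + h \<in> ?S \<longleftrightarrow> x \<in> ?S" for x
      using up[of x h] up[of "x + h" "- h"] convex_subgroup_uminus[OF H(1)] by auto
    then show "h \<in> invariance_group ?S" by (simp add: mem_invariance_group_iff)
  qed
  show "invariance_group ?S \<subseteq> H"
  proof
    fix d assume d: "d \<in> invariance_group ?S"
    have "convex_subgroup (invariance_group ?S)"
      by (intro convex_subgroup_invariance_group final_segment_strict_upper_translate H)
    then have d': "- d \<in> invariance_group ?S" using d convex_subgroup_uminus by blast
    \<comment> \<open>A positive e outside H would put \<alpha> + e into the segment, and invariance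
      would then pull \<alpha> in as well. Negative invariant elements are handled through their
      negatives.\<close>
    have pos: "e \<in> H" if "e \<in> invariance_group ?S" "0 < e" for e
    proof (rule ccontr)
      assume "e \<notin> H"
      then have "\<alpha> + e \<in> ?S"
        using convex_subgroup_less[OF H(1)] that by (simp add: mem_strict_upper_translate_iff)
      then have "\<alpha> \<in> ?S" using that by (simp add: mem_invariance_group_iff)
      then show False using diff_notin_of_mem_strict_upper[OF H(1)] by fastforce
    qed
    show "d \<in> H"
    proof (cases "d = 0")
      case True
      then show ?thesis using H by (simp add: convex_subgroup_def)
    next
      case False
      then consider "0 < d" | "0 < - d" by fastforce
      then show ?thesis
        using pos d d' convex_subgroup_uminus[OF H(1), of "- d"] by cases auto
    qed
  qed
qed

section \<open>Quotients by convex subgroups\<close>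

text \<open>Removes cosets from the argument: negated, the right-hand side says that y + h < x for
  every h in H. Having no least coset thus becomes a descent condition on elements.\<close>

lemma coset_le_translate_iff:
  assumes H: "convex_subgroup H"
  shows "coset_le (x +o H) (y +o H) \<longleftrightarrow> (\<exists>h\<in>H. x \<le> y + h)"
proof
  assume "coset_le (x +o H) (y +o H)"
  then obtain a b where ab: "a - x \<in> H" "b - y \<in> H" "a \<le> b"
    unfolding coset_le_def by (auto simp: mem_translate_iff)
  then have "(b - y) - (a - x) \<in> H" using H by (simp add: convex_subgroup_def)
  moreover have "x \<le> y + ((b - y) - (a - x))" using ab by (simp add: algebra_simps)
  ultimately show "\<exists>h\<in>H. x \<le> y + h" by blast
next
  assume "\<exists>h\<in>H. x \<le> y + h"
  then obtain h where h: "h \<in> H" "x \<le> y + h" by blast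
  then have "x \<in> x +o H" "y + h \<in> y +o H"
    using H by (auto simp: mem_translate_iff convex_subgroup_def)
  then show "coset_le (x +o H) (y +o H)" using h unfolding coset_le_def by blast
qed

lemma quot_nonprincipalD:
  assumes "convex_subgroup H" "quot_nonprincipal S H" "x \<in> S"
  obtains y where "y \<in> S" "\<And>h. h \<in> H \<Longrightarrow> y + h < x"
proof -
  have "\<exists>y\<in>S. \<not> coset_le (x +o H) (y +o H)"
    using assms unfolding nonprincipal_in_def quot_def by blast
  then show ?thesis
    using that coset_le_translate_iff[OF assms(1)] by (meson not_le)
qed

text \<open>Stability of S under H makes membership of a coset in S/H independent of the
  representative, so properness and upward closure pass to the quotient; the descent condition
  excludes a least coset.\<close>

lemma quot_nonprincipalI:
  assumes S: "final_segment S" and H: "convex_subgroup H" "H \<subseteq> invariance_group S"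
    and descend: "\<And>x. x \<in> S \<Longrightarrow> \<exists>y\<in>S. \<forall>h\<in>H. y + h < x"
  shows "quot_nonprincipal S H"
proof -
  have stable: "x + h \<in> S \<longleftrightarrow> x \<in> S" if "h \<in> H" for x h
    using H that by (auto simp: mem_invariance_group_iff)
  have mem: "x +o H \<in> quot S H \<longleftrightarrow> x \<in> S" for x
  proof
    assume "x +o H \<in> quot S H"
    then obtain s where s: "s \<in> S" "x +o H = s +o H" unfolding quot_def by blast
    moreover have "x \<in> x +o H" using H by (simp add: mem_translate_iff convex_subgroup_def)
    ultimately have "x - s \<in> H" by (simp add: mem_translate_iff)
    then show "x \<in> S" using stable[of "x - s" s] s by simp
  qed (simp add: quot_def)
  have "quot S H \<noteq> {}" "quot S H \<subseteq> quot UNIV H"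
    using S unfolding final_segment_in_def quot_def by auto
  moreover have "quot S H \<noteq> quot UNIV H"
  proof -
    obtain x where "x \<notin> S" using S unfolding final_segment_in_def by blast
    then have "x +o H \<notin> quot S H" "x +o H \<in> quot UNIV H" by (simp_all add: mem, simp add: quot_def)
    then show ?thesis by blast
  qed
  moreover have "y +o H \<in> quot S H" if xy: "x \<in> S" "coset_le (x +o H) (y +o H)" for x y
  proof -
    obtain h where "h \<in> H" "x \<le> y + h" using xy(2) by (auto simp: coset_le_translate_iff[OF H(1)])
    then have "y + h \<in> S" using final_segmentD[OF S xy(1)] by blast
    then show ?thesis using stable[OF \<open>h \<in> H\<close>] mem by simp
  qed
  moreover have "\<exists>y\<in>S. \<not> coset_le (x +o H) (y +o H)" if "x \<in> S" for x
    using descend[OF that] by (auto simp: coset_le_translate_iff[OF H(1)] not_le)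
  ultimately show ?thesis
    unfolding nonprincipal_in_def final_segment_in_def by (auto simp: quot_def)
qed

section \<open>Translates of S inside (\<alpha> + H)^+\<close>

lemma translate_subset_strict_upper:
  assumes S: "final_segment S" and x: "x \<in> strict_upper (\<alpha> +o invariance_group S)"
  obtains s where "s \<in> S"
    "\<And>y. y \<in> S \<Longrightarrow> x - s + y \<in> strict_upper (\<alpha> +o invariance_group S)"
proof -
  let ?H = "invariance_group S"
  have H: "convex_subgroup ?H" using convex_subgroup_invariance_group S by auto
  obtain s where s: "s \<in> S" "s - (x - \<alpha>) \<notin> S"
    using final_segment_drop_out[OF S] diff_notin_of_mem_strict_upper[OF H x] by metis
  have "\<alpha> + h < x - s + y" if y: "y \<in> S" and h: "h \<in> ?H" for y h
  proof -
    \<comment> \<open>If x - s + y \<le> \<alpha> + h held, then y - h, a member of S by stability,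
      would be at most s - (x - \<alpha>), forcing the latter into S.\<close>
    have "y + - h \<in> S" using y convex_subgroup_uminus[OF H h]
      by (simp only: mem_invariance_group_iff)
    then have "\<not> y + - h \<le> s - (x - \<alpha>)" using s final_segmentD[OF S] by blast
    then show ?thesis by (simp add: algebra_simps not_le)
  qed
  then show ?thesis using s that by (simp add: mem_strict_upper_translate_iff)
qed

lemma quot_nonprincipal_strict_upper:
  assumes S: "final_segment S" "quot_nonprincipal S (invariance_group S)"
  shows "quot_nonprincipal (strict_upper (\<alpha> +o invariance_group S)) (invariance_group S)"
proof -
  let ?H = "invariance_group S"
  have H: "convex_subgroup ?H" "?H \<noteq> UNIV"
    using convex_subgroup_invariance_group invariance_group_proper S by auto
  show ?thesis
  proof (rule quot_nonprincipalI)
    fix x assume x: "x \<in> strict_upper (\<alpha> +o ?H)"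
    obtain s where s: "s \<in> S" "\<And>y. y \<in> S \<Longrightarrow> x - s + y \<in> strict_upper (\<alpha> +o ?H)"
      using translate_subset_strict_upper[OF S(1) x] by blast
    obtain y where y: "y \<in> S" "\<And>h. h \<in> ?H \<Longrightarrow> y + h < s"
      using quot_nonprincipalD[OF H(1) S(2) s(1)] by blast
    \<comment> \<open>The shift by x - s carries s to x, so an element of S below s modulo H becomes
      an element of the segment below x modulo H.\<close>
    have "x - s + y + h < x" if h: "h \<in> ?H" for h
      using y(2)[OF h] by (simp add: algebra_simps)
    then show "\<exists>z\<in>strict_upper (\<alpha> +o ?H). \<forall>h\<in>?H. z + h < x" using s y by blast
  qed (use H in \<open>simp_all add: final_segment_strict_upper_translate
      invariance_group_strict_upper_translate\<close>)
qed

lemma plus_fs_diff_strict_upper: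
  assumes S: "final_segment S"
  shows "S + (strict_upper (\<alpha> +o invariance_group S) -\<^sub>f\<^sub>s S) =
    strict_upper (\<alpha> +o invariance_group S)" (is "S + (?S' -\<^sub>f\<^sub>s S) = ?S'")
proof
  show "S + (?S' -\<^sub>f\<^sub>s S) \<subseteq> ?S'"
    unfolding fs_diff_def elt_set_plus_def by (auto elim!: set_plus_elim simp: add.commute)
  show "?S' \<subseteq> S + (?S' -\<^sub>f\<^sub>s S)"
  proof
    fix x assume "x \<in> ?S'"
    then obtain s where s: "s \<in> S" "\<And>y. y \<in> S \<Longrightarrow> x - s + y \<in> ?S'"
      using translate_subset_strict_upper[OF S] by blast
    \<comment> \<open>The decomposition is x = s + (x - s): the choice of s says precisely that x -
      s translates S into the segment.\<close>
    then have "x - s \<in> ?S' -\<^sub>f\<^sub>s S" unfolding fs_diff_def elt_set_plus_def by auto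
    then have "s + (x - s) \<in> S + (?S' -\<^sub>f\<^sub>s S)" using s by (intro set_plus_intro)
    then show "x \<in> S + (?S' -\<^sub>f\<^sub>s S)" by simp
  qed
qed

lemma largest_final_segment_fs_diff:
  assumes S: "final_segment S" "final_segment S'" and sum: "S + (S' -\<^sub>f\<^sub>s S) = S'"
  shows "largest_final_segment (\<lambda>T. S + T = S') (S' -\<^sub>f\<^sub>s S)"
proof -
  have "S' -\<^sub>f\<^sub>s S \<noteq> {}"
    using S sum unfolding final_segment_in_def by (auto simp: set_plus_def)
  moreover have "S' -\<^sub>f\<^sub>s S \<noteq> UNIV"
  proof
    \<comment> \<open>For a fixed s in S, writing any x as s + (x - s) would then give S' =
      G.\<close>
    assume U: "S' -\<^sub>f\<^sub>s S = UNIV"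
    obtain s where s: "s \<in> S" using S unfolding final_segment_in_def by blast
    have "x \<in> S'" for x
      using set_plus_intro[OF s, of "x - s" "S' -\<^sub>f\<^sub>s S"] sum U by simp
    then show False using S unfolding final_segment_in_def by blast
  qed
  moreover have "y \<in> S' -\<^sub>f\<^sub>s S" if "x \<in> S' -\<^sub>f\<^sub>s S" "x \<le> y" for x y
    using that final_segmentD[OF S(2)] unfolding fs_diff_def elt_set_plus_def
    by (fastforce intro: add_right_mono)
  ultimately have "final_segment (S' -\<^sub>f\<^sub>s S)" unfolding final_segment_in_def by blast
  moreover have "T \<subseteq> S' -\<^sub>f\<^sub>s S" if "S + T = S'" for T
    using that unfolding fs_diff_def elt_set_plus_def by auto (metis add.commute set_plus_intro)
  ultimately show ?thesis using sum unfolding largest_final_segment_def by blast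
qed

section \<open>Upper bounds for the competing subsets\<close>

text \<open>If t \<le> \<alpha> + k for some k in H, then t - (h + k) \<le> \<alpha> - h. The left
  side stays in T, hence in S, and so \<alpha> - h would be in S.\<close>

lemma stable_subset_strict_upper:
  assumes S: "final_segment S" and "convex_subgroup H" "h \<in> H" "\<alpha> - h \<notin> S"
    and T: "T \<subseteq> S" "H \<subseteq> invariance_group T"
  shows "T \<subseteq> strict_upper (\<alpha> +o H)"
proof
  fix t assume t: "t \<in> T"
  have "\<alpha> + k < t" if k: "k \<in> H" for k
  proof -
    have "- (h + k) \<in> H"
      using assms k by (simp only: convex_subgroup_uminus convex_subgroup_add)
    then have "t + - (h + k) \<in> S" using t T mem_invariance_group_iff by blast
    then have "\<not> t + - (h + k) \<le> \<alpha> - h"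
      using final_segmentD[OF S] assms by blast
    then show ?thesis by (simp add: algebra_simps not_le)
  qed
  then show "t \<in> strict_upper (\<alpha> +o H)" by (simp add: mem_strict_upper_translate_iff)
qed

text \<open>Every element of S is at least \<alpha> modulo H, and each t in T lies above some y in T
  by more than H; so t lies above \<alpha> + H. Descent is phrased with elements so that the bound
  applies directly to translates of S1.\<close>

lemma descending_subset_strict_upper:
  assumes H: "convex_subgroup H"
    and S: "quot S H = segment_from_in (quot UNIV H) coset_le (\<alpha> +o H)"
    and T: "T \<subseteq> S" "\<And>x. x \<in> T \<Longrightarrow> \<exists>y\<in>T. \<forall>h\<in>H. y + h < x"
  shows "T \<subseteq> strict_upper (\<alpha> +o H)"
proof
  fix t assume "t \<in> T"
  then obtain y where y: "y \<in> T" "\<forall>h\<in>H. y + h < t" using T by blast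
  then have "y +o H \<in> quot S H" using T unfolding quot_def by blast
  then have "coset_le (\<alpha> +o H) (y +o H)" unfolding S segment_from_in_def by simp
  then obtain h where h: "h \<in> H" "\<alpha> \<le> y + h" by (auto simp: coset_le_translate_iff[OF H])
  have "\<alpha> + k < t" if k: "k \<in> H" for k
  proof -
    have "\<alpha> + k \<le> y + (h + k)" using h by (simp add: add.assoc[symmetric])
    also have "\<dots> < t" using y h k H convex_subgroup_add by blast
    finally show ?thesis .
  qed
  then show "t \<in> strict_upper (\<alpha> +o H)" by (simp add: mem_strict_upper_translate_iff)
qed

lemma fs_diff_eqI:
  assumes "S' \<subseteq> S2" "\<And>\<beta>. \<beta> +o S1 \<subseteq> S2 \<Longrightarrow> \<beta> +o S1 \<subseteq> S'"
  shows "S' -\<^sub>f\<^sub>s S1 = S2 -\<^sub>f\<^sub>s S1"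
  using assms unfolding fs_diff_def by blast

text \<open>Makes the bound for H-stable subsets applicable to the translates of S1 in the first
  case.\<close>

lemma invariance_group_translate:
  "invariance_group S \<subseteq> invariance_group (\<beta> +o S)"
proof
  fix g assume g: "g \<in> invariance_group S"
  have "x + g - \<beta> = x - \<beta> + g" for x by (simp add: algebra_simps)
  then show "g \<in> invariance_group (\<beta> +o S)"
    using g by (simp only: mem_invariance_group_iff mem_translate_iff simp_thms)
qed

lemma principal_in_segment_from:
  assumes "principal_in C le S"
  obtains m where "m \<in> S" "S = segment_from_in C le m"
proof -
  obtain m where m: "m \<in> S" "\<forall>x\<in>S. le m x" using assms unfolding principal_in_def by blast
  have "S \<subseteq> C" "\<forall>y\<in>C. le m y \<longrightarrow> y \<in> S"
    using assms m(1) unfolding principal_in_def final_segment_in_def by simp_all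
  then have "S = segment_from_in C le m" using m(2) unfolding segment_from_in_def by auto
  then show ?thesis using m(1) that by blast
qed

section \<open>The two cases of the theorem\<close>

theorem theorem2p34:
  fixes S1 S2 :: "'a::linordered_ab_group_add set"
  assumes "final_segment S1" and "final_segment S2"
  shows
    "(invariance_group S2 \<subset> invariance_group S1 \<longrightarrow>
        (\<exists>\<alpha>\<in>S2. let S2' = strict_upper (\<alpha> +o invariance_group S1) in
            S2' \<subset> S2 \<and>
            largest_final_segment
              (\<lambda>T. T \<subseteq> S2 \<and> invariance_group T = invariance_group S1) S2' \<and>
            invariance_group S1 \<subseteq> invariance_group S2' \<and>
            (quot_nonprincipal S1 (invariance_group S2') \<longrightarrow>
               quot_nonprincipal S2' (invariance_group S2')) \<and>
            largest_final_segment (\<lambda>T. S1 + T = S2') (S2' -\<^sub>f\<^sub>s S1) \<and>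
            S2' -\<^sub>f\<^sub>s S1 = S2 -\<^sub>f\<^sub>s S1))
     \<and>
     (invariance_group S1 = invariance_group S2 \<and>
      quot_nonprincipal S1 (invariance_group S1) \<and>
      quot_principal S2 (invariance_group S1) \<longrightarrow>
        (\<exists>\<alpha>\<in>S2. quot S2 (invariance_group S1) =
            segment_from_in (quot UNIV (invariance_group S1)) coset_le
              (\<alpha> +o invariance_group S1)) \<and>
        (\<forall>\<alpha>\<in>S2. quot S2 (invariance_group S1) =
            segment_from_in (quot UNIV (invariance_group S1)) coset_le
              (\<alpha> +o invariance_group S1) \<longrightarrow>
          (let S2' = strict_upper (\<alpha> +o invariance_group S1) in
            S2' \<subset> S2 \<and>
            largest_final_segment
              (\<lambda>T. T \<subseteq> S2 \<and> quot_nonprincipal T (invariance_group S1)) S2' \<and>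
            invariance_group S1 \<subseteq> invariance_group S2' \<and>
            (quot_nonprincipal S1 (invariance_group S2') \<longrightarrow>
               quot_nonprincipal S2' (invariance_group S2')) \<and>
            largest_final_segment (\<lambda>T. S1 + T = S2') (S2' -\<^sub>f\<^sub>s S1) \<and>
            S2' -\<^sub>f\<^sub>s S1 = S2 -\<^sub>f\<^sub>s S1)))"
proof (intro conjI impI)
  let ?H = "invariance_group S1"
  have H: "convex_subgroup ?H" "?H \<noteq> UNIV"
    using convex_subgroup_invariance_group invariance_group_proper assms by auto
  let ?U = "\<lambda>\<alpha>. strict_upper (\<alpha> +o ?H)"
  have U: "final_segment (?U \<alpha>)" "invariance_group (?U \<alpha>) = ?H" for \<alpha>
    using final_segment_strict_upper_translate[OF H]
      invariance_group_strict_upper_translate[OF H] by auto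
  have common: "largest_final_segment (\<lambda>T. S1 + T = ?U \<alpha>) (?U \<alpha> -\<^sub>f\<^sub>s S1)" for \<alpha>
    by (intro largest_final_segment_fs_diff assms U plus_fs_diff_strict_upper)
  {
    assume "invariance_group S2 \<subset> ?H"
    \<comment> \<open>The element \<alpha> is chosen so that a step down by a member of H leaves S2;
      hence no H-stable subset of S2 can reach down to \<alpha> + H.\<close>
    then obtain \<alpha> h where \<alpha>: "\<alpha> \<in> S2" "h \<in> ?H" "\<alpha> - h \<notin> S2"
      using invariance_group_drop_out[OF assms(2) H(1)] by blast
    have sub: "?U \<alpha> \<subset> S2" by (rule strict_upper_translate_subset) fact+
    have max: "T \<subseteq> ?U \<alpha>" if "T \<subseteq> S2" "?H \<subseteq> invariance_group T" for T
      by (rule stable_subset_strict_upper[OF assms(2) H(1) \<alpha>(2,3) that])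
    have "?U \<alpha> -\<^sub>f\<^sub>s S1 = S2 -\<^sub>f\<^sub>s S1"
      using sub max invariance_group_translate by (intro fs_diff_eqI) blast+
    moreover have "largest_final_segment
        (\<lambda>T. T \<subseteq> S2 \<and> invariance_group T = ?H) (?U \<alpha>)"
      unfolding largest_final_segment_def using sub max U by auto
    ultimately show "\<exists>\<alpha>\<in>S2. let S2' = ?U \<alpha> in
            S2' \<subset> S2 \<and>
            largest_final_segment
              (\<lambda>T. T \<subseteq> S2 \<and> invariance_group T = ?H) S2' \<and>
            ?H \<subseteq> invariance_group S2' \<and>
            (quot_nonprincipal S1 (invariance_group S2') \<longrightarrow>
               quot_nonprincipal S2' (invariance_group S2')) \<and>
            largest_final_segment (\<lambda>T. S1 + T = S2') (S2' -\<^sub>f\<^sub>s S1) \<and>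
            S2' -\<^sub>f\<^sub>s S1 = S2 -\<^sub>f\<^sub>s S1"
      \<comment> \<open>Rewriting the invariance group of the segment to H makes its inclusion
        trivial and turns the nonprincipality condition into
        \<open>quot_nonprincipal_strict_upper\<close>.\<close>
      unfolding Let_def U(2)
      using \<alpha>(1) sub common quot_nonprincipal_strict_upper[OF assms(1)] by blast
  }
  assume case2: "?H = invariance_group S2 \<and> quot_nonprincipal S1 ?H \<and> quot_principal S2 ?H"
  \<comment> \<open>The least coset m lies in S2/H, so it has a representative in S2, which serves
    as \<alpha>.\<close>
  then obtain m where "m \<in> quot S2 ?H"
    "quot S2 ?H = segment_from_in (quot UNIV ?H) coset_le m"
    using principal_in_segment_from by metis
  then show "\<exists>\<alpha>\<in>S2. quot S2 ?H = segment_from_in (quot UNIV ?H) coset_le (\<alpha> +o ?H)"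
    unfolding quot_def by blast
  show "\<forall>\<alpha>\<in>S2. quot S2 ?H = segment_from_in (quot UNIV ?H) coset_le (\<alpha> +o ?H) \<longrightarrow>
          (let S2' = ?U \<alpha> in
            S2' \<subset> S2 \<and>
            largest_final_segment
              (\<lambda>T. T \<subseteq> S2 \<and> quot_nonprincipal T ?H) S2' \<and>
            ?H \<subseteq> invariance_group S2' \<and>
            (quot_nonprincipal S1 (invariance_group S2') \<longrightarrow>
               quot_nonprincipal S2' (invariance_group S2')) \<and>
            largest_final_segment (\<lambda>T. S1 + T = S2') (S2' -\<^sub>f\<^sub>s S1) \<and>
            S2' -\<^sub>f\<^sub>s S1 = S2 -\<^sub>f\<^sub>s S1)"
  proof (intro ballI impI)
    fix \<alpha> assume \<alpha>: "\<alpha> \<in> S2"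
      and seg: "quot S2 ?H = segment_from_in (quot UNIV ?H) coset_le (\<alpha> +o ?H)"
    have sub: "?U \<alpha> \<subset> S2" by (rule strict_upper_translate_subset) fact+
    have max: "T \<subseteq> ?U \<alpha>" if "T \<subseteq> S2" "\<And>x. x \<in> T \<Longrightarrow> \<exists>y\<in>T. \<forall>h\<in>?H. y + h < x" for T
      by (rule descending_subset_strict_upper[OF H(1) seg that])
    \<comment> \<open>A translate of S1 inherits the descent of S1: for x in it, descend from x -
      \<beta> in S1 and add \<beta> back.\<close>
    have "\<beta> +o S1 \<subseteq> ?U \<alpha>" if \<beta>: "\<beta> +o S1 \<subseteq> S2" for \<beta>
    proof (rule max[OF \<beta>])
      fix x assume "x \<in> \<beta> +o S1"
      then obtain y where "y \<in> S1" "\<And>h. h \<in> ?H \<Longrightarrow> y + h < x - \<beta>"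
        using quot_nonprincipalD[OF H(1)] case2 by (metis mem_translate_iff)
      then show "\<exists>y\<in>\<beta> +o S1. \<forall>h\<in>?H. y + h < x"
        by (intro bexI[of _ "\<beta> + y"]) (auto simp: mem_translate_iff algebra_simps)
    qed
    then have diff: "?U \<alpha> -\<^sub>f\<^sub>s S1 = S2 -\<^sub>f\<^sub>s S1"
      using sub by (intro fs_diff_eqI) auto
    have "T \<subseteq> ?U \<alpha>" if "T \<subseteq> S2" "quot_nonprincipal T ?H" for T
      using max[OF that(1)] quot_nonprincipalD[OF H(1) that(2)] by metis
    moreover have np: "quot_nonprincipal (?U \<alpha>) ?H"
      using quot_nonprincipal_strict_upper[OF assms(1)] case2 by blast
    ultimately have "largest_final_segment (\<lambda>T. T \<subseteq> S2 \<and> quot_nonprincipal T ?H) (?U \<alpha>)"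
      unfolding largest_final_segment_def using sub U by auto
    then show "let S2' = ?U \<alpha> in
            S2' \<subset> S2 \<and>
            largest_final_segment
              (\<lambda>T. T \<subseteq> S2 \<and> quot_nonprincipal T ?H) S2' \<and>
            ?H \<subseteq> invariance_group S2' \<and>
            (quot_nonprincipal S1 (invariance_group S2') \<longrightarrow>
               quot_nonprincipal S2' (invariance_group S2')) \<and>
            largest_final_segment (\<lambda>T. S1 + T = S2') (S2' -\<^sub>f\<^sub>s S1) \<and>
            S2' -\<^sub>f\<^sub>s S1 = S2 -\<^sub>f\<^sub>s S1"
      unfolding Let_def U(2) using sub common np diff by blast
  qed
qed

end
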